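(* Let $n\geqslant 1$ be an integer and let $A_1,\ldots,A_n$ be Hermitian positive semidefinite complex matrices of the same size. Then for each integer $p\geqslant 1$, in the Löwner order, $$(n-2)\sum_{i=1}^n A_i^{\otimes p} + \Bigl(\sum_{i=1}^n A_i\Bigr)^{\otimes p} \ \geqslant\ \sum_{1\leqslant i<j\leqslant n} (A_i+A_j)^{\otimes p}.$$
   Context: For a matrix $A$, $A^{\otimes p}=A\otimes\cdots\otimes A$ ($p$ factors) is the Kronecker (tensor) power. For Hermitian $X,Y$ of the same size, $X\geqslant Y$ (Löwner order) means that $X-Y$ is positive semidefinite. *)

theory Defs
  imports "Jordan_Normal_Form.Schur_Decomposition"
begin

(* Entry (i, j) of A \<otimes> B: the row index i = i1 * dim_row B + i2 encodes the pair (i1, i2)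
   lexicographically, and likewise for the column index. *)
definition kronecker :: "'a::semiring_1 mat \<Rightarrow> 'a mat \<Rightarrow> 'a mat" where
  "kronecker A B = mat (dim_row A * dim_row B) (dim_col A * dim_col B)
     (\<lambda>(i, j). A $$ (i div dim_row B, j div dim_col B) * B $$ (i mod dim_row B, j mod dim_col B))"

(* The empty tensor power is the 1 x 1 identity, the unit of the Kronecker product. *)
fun tensor_power :: "'a::semiring_1 mat \<Rightarrow> nat \<Rightarrow> 'a mat" where
  "tensor_power A 0 = 1\<^sub>m 1"
| "tensor_power A (Suc p) = kronecker A (tensor_power A p)"

(* JNF matrices are not an instance of comm_monoid_add (there is no dimension-independent zero),
   so sums are taken in the additive monoid of nr x nc matrices, as for finsum_vec. *)
definition finsum_mat :: "'a::monoid_add itself \<Rightarrow> nat \<Rightarrow> nat \<Rightarrow> ('i \<Rightarrow> 'a mat) \<Rightarrow> 'i set \<Rightarrow> 'a mat" where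
  "finsum_mat ty nr nc = finprod (monoid_mat ty nr nc)"

definition hermitian :: "complex mat \<Rightarrow> bool" where
  "hermitian A \<longleftrightarrow> mat_adjoint A = A"

(* The quadratic form is v^* A v.  On complex numbers, 0 \<le> z means that z is real and nonnegative. *)
definition positive_semidefinite :: "complex mat \<Rightarrow> bool" where
  "positive_semidefinite A \<longleftrightarrow>
     hermitian A \<and> (\<forall>v \<in> carrier_vec (dim_row A). 0 \<le> (A *\<^sub>v v) \<bullet>c v)"

(* loewner_le Y X is Y \<le> X.  The dimension conditions are needed because subtraction of JNF
   matrices is total. *)
definition loewner_le :: "complex mat \<Rightarrow> complex mat \<Rightarrow> bool" where
  "loewner_le Y X \<longleftrightarrow> hermitian X \<and> hermitian Y \<and>
     dim_row X = dim_row Y \<and> dim_col X = dim_col Y \<and> positive_semidefinite (X - Y)"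

lemma mat_adjoint_dim:
  "dim_row (mat_adjoint A) = dim_col A" "dim_col (mat_adjoint A) = dim_row A"
  by (simp_all add: mat_adjoint_def)

lemma hermitian_square: "hermitian A \<Longrightarrow> dim_row A = dim_col A"
  by (metis hermitian_def mat_adjoint_dim(1))

lemma hermitian_iff:
  assumes "A \<in> carrier_mat d d"
  shows "hermitian A \<longleftrightarrow> (\<forall>i<d. \<forall>j<d. A $$ (i, j) = cnj (A $$ (j, i)))"
proof -
  have entry: "mat_adjoint A $$ (i, j) = cnj (A $$ (j, i))" if "i < d" "j < d" for i j
    using that assms by (simp add: mat_adjoint_def mat_of_rows_index)
  have dims: "dim_row (mat_adjoint A) = d" "dim_col (mat_adjoint A) = d"
    using assms by (auto simp: mat_adjoint_dim)
  show ?thesis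
  proof
    assume "hermitian A"
    then have "mat_adjoint A = A" by (simp add: hermitian_def)
    then have "A $$ (i, j) = cnj (A $$ (j, i))" if "i < d" "j < d" for i j
      using entry[OF that] by argo
    then show "\<forall>i<d. \<forall>j<d. A $$ (i, j) = cnj (A $$ (j, i))"
      by blast
  next
    assume "\<forall>i<d. \<forall>j<d. A $$ (i, j) = cnj (A $$ (j, i))"
    then have "mat_adjoint A = A"
      using assms entry dims by (intro eq_matI) (metis carrier_matD)+
    then show "hermitian A" by (simp add: hermitian_def)
  qed
qed

lemma tensor_power_carrier:
  assumes "A \<in> carrier_mat m n"
  shows "tensor_power A p \<in> carrier_mat (m ^ p) (n ^ p)"
  using assms by (induction p) (auto simp: kronecker_def)

lemma tensor_power_1: "tensor_power A 1 = A"
  by (rule eq_matI) (auto simp: kronecker_def)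

lemma finsum_mat_empty: "finsum_mat ty nr nc f {} = 0\<^sub>m nr nc"
  by (simp add: finsum_mat_def finprod_def monoid_mat_def)

lemma finsum_mat_insert:
  fixes f :: "'i \<Rightarrow> 'a::comm_monoid_add mat"
  assumes "finite S" "i \<notin> S" "\<And>j. j \<in> insert i S \<Longrightarrow> f j \<in> carrier_mat nr nc"
  shows "finsum_mat TYPE('a) nr nc f (insert i S) = f i + finsum_mat TYPE('a) nr nc f S"
proof -
  interpret comm_monoid "monoid_mat TYPE('a) nr nc"
    by (rule comm_monoid_mat)
  have "f \<in> S \<rightarrow> carrier (monoid_mat TYPE('a) nr nc)" "f i \<in> carrier (monoid_mat TYPE('a) nr nc)"
    using assms(3) by (auto simp: monoid_mat_def)
  then show ?thesis
    using finprod_insert[OF assms(1,2)] by (simp add: finsum_mat_def monoid_mat_def)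
qed

lemma finsum_mat_entries:
  fixes f :: "'i \<Rightarrow> 'a::comm_monoid_add mat"
  assumes "finite S" "\<And>i. i \<in> S \<Longrightarrow> f i \<in> carrier_mat nr nc"
  shows "finsum_mat TYPE('a) nr nc f S = mat nr nc (\<lambda>(r, c). \<Sum>i\<in>S. f i $$ (r, c))"
  using assms
proof (induction S)
  case empty
  show ?case by (rule eq_matI) (auto simp: finsum_mat_empty)
next
  case (insert i S)
  have "f i \<in> carrier_mat nr nc" using insert.prems by simp
  with insert show ?case
    by (subst finsum_mat_insert) (auto intro!: eq_matI)
qed

end

theory Submission
  imports Defs
begin

text \<open>
  Distributing the tensor product over a sum writes \<open>(\<Sum>i\<in>S. A i)\<^sup>\<otimes>\<^sup>p\<close> as the sum, over
  all words \<open>w\<close> of length \<open>p\<close> with letters in \<open>S\<close>, of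
  \<open>A (w\<^sub>1) \<otimes> \<dots> \<otimes> A (w\<^sub>p)\<close> (\<open>tensor_power_finsum_index\<close>). Apply this to
  \<open>S = {1..n}\<close>, \<open>S = {i, j}\<close> and \<open>S = {i}\<close>. In the difference of the two sides of the
  inequality, the coefficient of the word \<open>w\<close> depends only on the number of distinct letters of \<open>w\<close>:

  \<^item> one letter: \<open>(n - 2) + 1 - (n - 1) = 0\<close>, as that letter lies in \<open>n - 1\<close> pairs;
  \<^item> two letters: \<open>0 + 1 - 1 = 0\<close>, as exactly one pair contains both;
  \<^item> three or more letters: \<open>0 + 1 - 0 = 1\<close>.

  So the difference is the sum of the tensor products over the words with at least three distinct
  letters (\<open>sum_words_inclusion_exclusion\<close>). Each of these products is positive semidefinite, because
  Kronecker products preserve positive semidefiniteness (\<open>positive_semidefinite_kronecker\<close>).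

  For that last fact, one factor is written as a Gram matrix, a sum of rank-one matrices
  \<open>u u\<^sup>*\<close> (\<open>gram_representation\<close>), which is the entrywise form of a factorization
  \<open>A = U U\<^sup>*\<close>. It is obtained by symmetric Gaussian elimination, as in the Cholesky
  decomposition, so that no spectral theorem is involved.
\<close>

section \<open>Gram representations\<close>

text \<open>
  If \<open>a k k = 0\<close> but \<open>a i k \<noteq> 0\<close>, then the form restricted to the coordinates \<open>i\<close> and \<open>k\<close>
  is affine in the size of the \<open>k\<close> coordinate, with a nonzero slope for a suitable phase, and hence
  takes a negative value. In the elimination below this is the case of a vanishing pivot.
\<close>

lemma zero_column_of_zero_diagonal:
  fixes a :: "'a \<Rightarrow> 'a \<Rightarrow> complex"
  assumes "finite I" "k \<notin> I" "i \<in> I"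
    and herm: "\<And>i j. i \<in> insert k I \<Longrightarrow> j \<in> insert k I \<Longrightarrow> a i j = cnj (a j i)"
    and nonneg: "\<And>x. 0 \<le> (\<Sum>i\<in>insert k I. \<Sum>j\<in>insert k I. a i j * x j * cnj (x i))"
    and "a k k = 0"
  shows "a i k = 0"
proof (rule ccontr)
  assume "a i k \<noteq> 0"
  \<comment> \<open>At \<open>x i = 1\<close>, \<open>x k = - t * cnj (a i k)\<close> the form has the value \<open>a i i - 2 * t * s\<close>, and
    \<open>t\<close> makes this equal to \<open>-1\<close>.\<close>
  define s where "s = (cmod (a i k))\<^sup>2"
  define t where "t = (Re (a i i) + 1) / (2 * s)"
  define x where "x = (\<lambda>m. if m = i then 1 else if m = k then - of_real t * cnj (a i k) else 0)"
  have "s > 0" using \<open>a i k \<noteq> 0\<close> by (simp add: s_def)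
  have ki: "a k i = cnj (a i k)" using \<open>i \<in> I\<close> by (intro herm) auto
  have "k \<noteq> i" using assms by blast
  have inner: "(\<Sum>j\<in>insert k I. a m j * x j * cnj (x m))
      = (a m i - a m k * of_real t * cnj (a i k)) * cnj (x m)" for m
  proof -
    have "(\<Sum>j\<in>insert k I. a m j * x j * cnj (x m))
        = (\<Sum>j\<in>{i, k}. a m j * x j * cnj (x m))"
      using assms(1,3) by (intro sum.mono_neutral_right) (auto simp: x_def)
    also have "\<dots> = (a m i - a m k * of_real t * cnj (a i k)) * cnj (x m)"
      using \<open>k \<noteq> i\<close> by (simp add: x_def algebra_simps)
    finally show ?thesis .
  qed
  have "(\<Sum>m\<in>insert k I. \<Sum>j\<in>insert k I. a m j * x j * cnj (x m))
      = (\<Sum>m\<in>{i, k}. (a m i - a m k * of_real t * cnj (a i k)) * cnj (x m))"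
    unfolding inner
    using assms(1,3) by (intro sum.mono_neutral_right) (auto simp: x_def)
  also have "\<dots> = a i i - 2 * of_real t * (a i k * cnj (a i k))"
    using \<open>k \<noteq> i\<close> \<open>a k k = 0\<close> by (simp add: x_def ki algebra_simps)
  also have "\<dots> = a i i - of_real (2 * t * s)"
    by (simp add: s_def complex_norm_square del: of_real_power)
  finally have "0 \<le> a i i - of_real (2 * t * s)"
    using nonneg[of x] by simp
  then have "2 * t * s \<le> Re (a i i)"
    by (simp add: less_eq_complex_def)
  then show False
    using \<open>s > 0\<close> by (simp add: t_def)
qed

text \<open>
  Eliminating the index \<open>k\<close> subtracts from \<open>a\<close> the rank-one matrix built from its \<open>k\<close>-th column.
  The remainder is the Schur complement \<open>b\<close>, whose form is nonnegative because its value at \<open>x\<close>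
  is the value of the form of \<open>a\<close> at the extension of \<open>x\<close> that minimizes the latter. When the pivot
  vanishes, so do its row and column, and nothing has to be subtracted. The matrix is a function on
  an arbitrary finite index set, so that the induction can run over index sets instead of sizes.
\<close>

lemma gram_representation:
  fixes a :: "'a \<Rightarrow> 'a \<Rightarrow> complex"
  assumes "finite I"
    and "\<And>i j. i \<in> I \<Longrightarrow> j \<in> I \<Longrightarrow> a i j = cnj (a j i)"
    and "\<And>x. 0 \<le> (\<Sum>i\<in>I. \<Sum>j\<in>I. a i j * x j * cnj (x i))"
  shows "\<exists>u. \<forall>i\<in>I. \<forall>j\<in>I. a i j = (\<Sum>m\<in>I. u m i * cnj (u m j))"
  using assms
proof (induction I arbitrary: a)
  case empty
  then show ?case by simp
next
  case (insert k I)
  define q where "q = a k k"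
  \<comment> \<open>For \<open>q = 0\<close> the quotient is \<open>0\<close> by convention, so \<open>b = a\<close>, as the elimination requires.\<close>
  define b where "b = (\<lambda>i j. a i j - a i k * a k j / q)"
  note herm = insert.prems(1) and nonneg = insert.prems(2)
  have split: "(\<Sum>i\<in>insert k I. \<Sum>j\<in>insert k I. a i j * x j * cnj (x i))
      = q * x k * cnj (x k) + (\<Sum>j\<in>I. a k j * x j) * cnj (x k)
        + x k * (\<Sum>i\<in>I. a i k * cnj (x i)) + (\<Sum>i\<in>I. \<Sum>j\<in>I. a i j * x j * cnj (x i))" for x
  proof -
    have "(\<Sum>j\<in>I. a k j * x j) * cnj (x k) = (\<Sum>j\<in>I. a k j * x j * cnj (x k))"
      by (rule sum_distrib_right)
    moreover have "x k * (\<Sum>i\<in>I. a i k * cnj (x i)) = (\<Sum>i\<in>I. a i k * x k * cnj (x i))"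
      by (simp add: sum_distrib_left mult.left_commute mult.assoc)
    ultimately show ?thesis
      using insert.hyps by (simp add: q_def sum.distrib)
  qed
  have "0 \<le> q"
  proof -
    have "(\<Sum>j\<in>I. a k j * of_bool (j = k)) = 0" "(\<Sum>i\<in>I. a i k * cnj (of_bool (i = k))) = 0"
      "(\<Sum>i\<in>I. \<Sum>j\<in>I. a i j * of_bool (j = k) * cnj (of_bool (i = k))) = 0"
      using insert.hyps by (auto intro!: sum.neutral)
    then show ?thesis
      using nonneg[of "\<lambda>i. of_bool (i = k)"] unfolding split by simp
  qed
  then have "cnj q = q" "q = of_real (Re q)" "0 \<le> Re q"
    by (auto simp: less_eq_complex_def complex_eq_iff)
  have zero: "a i k = 0" "a k i = 0" if "q = 0" "i \<in> I" for i
  proof -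
    show "a i k = 0"
    proof (rule zero_column_of_zero_diagonal[of I k i a])
      show "a k k = 0" using that q_def by metis
    qed (fact insert.hyps that herm nonneg)+
    then show "a k i = 0"
      using herm[of k i] \<open>i \<in> I\<close> by simp
  qed
  have "\<exists>u. \<forall>i\<in>I. \<forall>j\<in>I. b i j = (\<Sum>m\<in>I. u m i * cnj (u m j))"
  proof (rule insert.IH)
    fix i j assume "i \<in> I" "j \<in> I"
    then have "a i j = cnj (a j i)" "a i k = cnj (a k i)" "a k j = cnj (a j k)"
      by (blast intro: herm)+
    then show "b i j = cnj (b j i)"
      by (simp add: b_def \<open>cnj q = q\<close> mult.commute)
  next
    fix x :: "'a \<Rightarrow> complex"
    define S where "S = (\<Sum>j\<in>I. a k j * x j)"
    \<comment> \<open>\<open>y\<close> completes the square: \<open>- S / q\<close> is the minimizer of the form in the \<open>k\<close> coordinate.\<close>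
    define y where "y = x(k := - S / q)"
    have cnj_S: "(\<Sum>i\<in>I. a i k * cnj (x i)) = cnj S"
      unfolding S_def cnj_sum by (intro sum.cong refl) (simp add: herm[of _ k])
    have y: "y k = - S / q" "\<And>i. i \<in> I \<Longrightarrow> y i = x i"
      using insert.hyps by (auto simp: y_def)
    have "(\<Sum>i\<in>I. \<Sum>j\<in>I. b i j * x j * cnj (x i))
        = (\<Sum>i\<in>I. \<Sum>j\<in>I. a i j * x j * cnj (x i)) - S * cnj S / q"
    proof -
      have "(\<Sum>i\<in>I. \<Sum>j\<in>I. a i k * a k j / q * x j * cnj (x i))
          = (\<Sum>i\<in>I. \<Sum>j\<in>I. (a i k * cnj (x i)) * (a k j * x j) / q)"
        by (intro sum.cong refl) simp
      also have "\<dots> = cnj S * S / q"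
        unfolding cnj_S[symmetric] unfolding S_def
        by (simp only: sum_product sum_divide_distrib)
      also have "\<dots> = S * cnj S / q"
        by (simp only: mult.commute)
      finally show ?thesis
        by (simp add: b_def left_diff_distrib sum_subtractf)
    qed
    also have "\<dots> = q * y k * cnj (y k) + S * cnj (y k) + y k * cnj S
        + (\<Sum>i\<in>I. \<Sum>j\<in>I. a i j * x j * cnj (x i))"
      by (cases "q = 0") (auto simp: y \<open>cnj q = q\<close> field_simps)
    also have "\<dots> = (\<Sum>i\<in>insert k I. \<Sum>j\<in>insert k I. a i j * y j * cnj (y i))"
      unfolding split by (simp add: y cnj_S S_def cong: sum.cong)
    finally show "0 \<le> (\<Sum>i\<in>I. \<Sum>j\<in>I. b i j * x j * cnj (x i))"
      using nonneg[of y] by simp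
  qed
  then obtain u where u: "\<And>i j. i \<in> I \<Longrightarrow> j \<in> I \<Longrightarrow> b i j = (\<Sum>m\<in>I. u m i * cnj (u m j))"
    by blast
  define r where "r = complex_of_real (sqrt (Re q))"
  have "r * r = of_real (Re q)" "cnj r = r"
    using \<open>0 \<le> Re q\<close> by (simp_all add: r_def flip: of_real_mult)
  then have r: "r * r = q" "cnj r = r" "r = 0 \<longleftrightarrow> q = 0"
    using \<open>q = of_real (Re q)\<close> by auto
  \<comment> \<open>The vector with index \<open>k\<close> is the \<open>k\<close>-th column of \<open>a\<close> divided by the root of the pivot; the others
    come from the Schur complement and vanish at \<open>k\<close>.\<close>
  define v where
    "v = (\<lambda>m i. if m = k then (if i = k then r else a i k / r) else if i = k then 0 else u m i)"
  have rest: "(\<Sum>m\<in>I. v m i * cnj (v m j))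
      = (if i = k \<or> j = k then 0 else b i j)" if "i \<in> insert k I" "j \<in> insert k I" for i j
  proof -
    have "(\<Sum>m\<in>I. v m i * cnj (v m j))
        = (\<Sum>m\<in>I. if i = k \<or> j = k then 0 else u m i * cnj (u m j))"
      using insert.hyps by (intro sum.cong) (auto simp: v_def)
    then show ?thesis using u that by auto
  qed
  have "a i j = (\<Sum>m\<in>insert k I. v m i * cnj (v m j))"
    if ij: "i \<in> insert k I" "j \<in> insert k I" for i j
  proof -
    have "a i j = v k i * cnj (v k j) + (if i = k \<or> j = k then 0 else b i j)"
    proof (cases "q = 0")
      case True
      then show ?thesis
        using ij zero r by (auto simp: v_def b_def simp flip: q_def)
    next
      case False
      have jk: "a k j = cnj (a j k)" using ij by (intro herm) auto
      show ?thesis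
        using False r by (auto simp: v_def b_def jk simp flip: q_def)
    qed
    then show ?thesis
      using insert.hyps by (simp add: rest[OF ij])
  qed
  then show ?case by blast
qed

section \<open>Positive semidefinite matrices\<close>

text \<open>
  Scalar sums over functions on indices are easier to reorder than inner products of vectors, which
  matters for Kronecker products, where each index is a pair.
\<close>

lemma positive_semidefinite_iff_quadratic_form:
  assumes "A \<in> carrier_mat d d"
  shows "positive_semidefinite A \<longleftrightarrow> hermitian A \<and>
    (\<forall>x. 0 \<le> (\<Sum>i<d. \<Sum>j<d. A $$ (i, j) * x j * cnj (x i)))"
proof -
  have form: "(A *\<^sub>v v) \<bullet>c v = (\<Sum>i<d. \<Sum>j<d. A $$ (i, j) * v $ j * cnj (v $ i))"
    if "v \<in> carrier_vec d" for v
    using that assms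
    by (auto simp: scalar_prod_def sum_distrib_right lessThan_atLeast0 intro!: sum.cong)
  have "0 \<le> (\<Sum>i<d. \<Sum>j<d. A $$ (i, j) * x j * cnj (x i))"
    if "\<forall>v\<in>carrier_vec d. 0 \<le> (A *\<^sub>v v) \<bullet>c v" for x
    using bspec[OF that, of "vec d x"] by (simp add: form)
  then show ?thesis
    using assms form by (auto simp: positive_semidefinite_def)
qed

lemma hermitianD:
  "hermitian A \<Longrightarrow> A \<in> carrier_mat d d \<Longrightarrow> i < d \<Longrightarrow> j < d \<Longrightarrow>
    cnj (A $$ (i, j)) = A $$ (j, i)"
  using hermitian_iff[of A d] by metis

lemma hermitian_add:
  assumes "A \<in> carrier_mat d d" "B \<in> carrier_mat d d" "hermitian A" "hermitian B"
  shows "hermitian (A + B)"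
proof -
  have "A + B \<in> carrier_mat d d" using assms by simp
  moreover have "(A + B) $$ (i, j) = cnj ((A + B) $$ (j, i))" if "i < d" "j < d" for i j
    using assms that by (simp add: hermitianD)
  ultimately show ?thesis using hermitian_iff by blast
qed

lemma hermitian_real_smult:
  assumes "A \<in> carrier_mat d d" "hermitian A" "c \<in> \<real>"
  shows "hermitian (c \<cdot>\<^sub>m A)"
proof -
  have "c \<cdot>\<^sub>m A \<in> carrier_mat d d" using assms by simp
  moreover have "(c \<cdot>\<^sub>m A) $$ (i, j) = cnj ((c \<cdot>\<^sub>m A) $$ (j, i))" if "i < d" "j < d" for i j
    using assms that by (simp add: hermitianD Reals_cnj_iff)
  ultimately show ?thesis using hermitian_iff by blast
qed

lemma positive_semidefinite_add:
  assumes "A \<in> carrier_mat d d" "B \<in> carrier_mat d d"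
    and "positive_semidefinite A" "positive_semidefinite B"
  shows "positive_semidefinite (A + B)"
proof -
  have AB: "A + B \<in> carrier_mat d d" using assms by simp
  have "0 \<le> (\<Sum>i<d. \<Sum>j<d. (A + B) $$ (i, j) * x j * cnj (x i))" for x
  proof -
    have "(\<Sum>i<d. \<Sum>j<d. (A + B) $$ (i, j) * x j * cnj (x i))
        = (\<Sum>i<d. \<Sum>j<d. A $$ (i, j) * x j * cnj (x i))
          + (\<Sum>i<d. \<Sum>j<d. B $$ (i, j) * x j * cnj (x i))"
      unfolding sum.distrib[symmetric] using assms(1,2)
      by (intro sum.cong refl) (simp add: distrib_right)
    then show ?thesis
      using assms(3,4) unfolding positive_semidefinite_iff_quadratic_form[OF assms(1)]
        positive_semidefinite_iff_quadratic_form[OF assms(2)]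
      by (simp only: add_nonneg_nonneg)
  qed
  moreover have "hermitian (A + B)"
    using assms hermitian_add positive_semidefinite_def by blast
  ultimately show ?thesis
    using positive_semidefinite_iff_quadratic_form[OF AB] by blast
qed

lemma positive_semidefinite_zero: "positive_semidefinite (0\<^sub>m d d)"
proof -
  have "hermitian (0\<^sub>m d d)" using hermitian_iff[of "0\<^sub>m d d" d] by simp
  then show ?thesis by (simp add: positive_semidefinite_iff_quadratic_form[of _ d])
qed

lemma positive_semidefinite_one: "positive_semidefinite (1\<^sub>m 1)"
proof -
  have "hermitian (1\<^sub>m 1)" using hermitian_iff[of "1\<^sub>m 1" 1] by simp
  then show ?thesis
    by (simp add: positive_semidefinite_iff_quadratic_form[of _ 1] less_eq_complex_def)
qed

lemma finsum_mat_carrier: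
  fixes f :: "'i \<Rightarrow> 'a::comm_monoid_add mat"
  assumes "finite S" "\<And>i. i \<in> S \<Longrightarrow> f i \<in> carrier_mat nr nc"
  shows "finsum_mat TYPE('a) nr nc f S \<in> carrier_mat nr nc"
  by (simp add: finsum_mat_entries[OF assms])

lemma positive_semidefinite_finsum:
  assumes "finite S" "\<And>i. i \<in> S \<Longrightarrow> f i \<in> carrier_mat d d"
    and "\<And>i. i \<in> S \<Longrightarrow> positive_semidefinite (f i)"
  shows "positive_semidefinite (finsum_mat TYPE(complex) d d f S)"
  using assms
proof (induction S)
  case empty
  show ?case by (simp add: finsum_mat_empty positive_semidefinite_zero)
next
  case (insert i S)
  then show ?case
    by (subst finsum_mat_insert)
      (auto intro!: positive_semidefinite_add[of _ d] finsum_mat_carrier)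
qed

section \<open>Kronecker products of positive semidefinite matrices\<close>

lemma kronecker_carrier:
  "A \<in> carrier_mat m n \<Longrightarrow> B \<in> carrier_mat m' n' \<Longrightarrow>
    kronecker A B \<in> carrier_mat (m * m') (n * n')"
  by (simp add: kronecker_def)

lemma kronecker_index:
  assumes "A \<in> carrier_mat m n" "B \<in> carrier_mat m' n'" "r < m * m'" "c < n * n'"
  shows "kronecker A B $$ (r, c)
    = A $$ (r div m', c div n') * B $$ (r mod m', c mod n')"
  using assms by (simp add: kronecker_def)

text \<open>
  Division with remainder is the bijection between the indices of a Kronecker product and the pairs
  of indices of its factors.
\<close>

lemma sum_div_mod:
  fixes f :: "nat \<Rightarrow> nat \<Rightarrow> 'a::comm_monoid_add"
  shows "(\<Sum>r<d * e. f (r div e) (r mod e)) = (\<Sum>i<d. \<Sum>k<e. f i k)"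
proof -
  have "(\<Sum>r<d * e. f (r div e) (r mod e))
      = (\<Sum>i<d. \<Sum>r=i * e..<i * e + e. f (r div e) (r mod e))"
    by (rule sum.nat_group[symmetric])
  also have "\<dots> = (\<Sum>i<d. \<Sum>k<e. f i k)"
  proof (rule sum.cong[OF refl])
    fix i
    have "(\<Sum>r=i * e..<i * e + e. f (r div e) (r mod e))
        = (\<Sum>k=0..<e. f ((k + i * e) div e) ((k + i * e) mod e))"
      using sum.shift_bounds_nat_ivl[of "\<lambda>r. f (r div e) (r mod e)" 0 "i * e" e]
      by (simp add: add.commute)
    also have "\<dots> = (\<Sum>k<e. f i k)"
      unfolding lessThan_atLeast0 by (intro sum.cong) auto
    finally show "(\<Sum>r=i * e..<i * e + e. f (r div e) (r mod e)) = (\<Sum>k<e. f i k)" .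
  qed
  finally show ?thesis .
qed

text \<open>
  With \<open>A = (\<Sum>m. u m (u m)\<^sup>*)\<close>, contracting the first tensor coordinate of \<open>x\<close> against
  the conjugate of \<open>u m\<close> gives a vector \<open>y m\<close>, and the form of \<open>A \<otimes> B\<close> at \<open>x\<close> is the sum over \<open>m\<close> of the
  values of the form of \<open>B\<close> at \<open>y m\<close>.
\<close>

lemma positive_semidefinite_kronecker:
  assumes A: "A \<in> carrier_mat d d" "positive_semidefinite A"
    and B: "B \<in> carrier_mat e e" "positive_semidefinite B"
  shows "positive_semidefinite (kronecker A B)"
proof -
  have K: "kronecker A B \<in> carrier_mat (d * e) (d * e)"
    using A B by (simp add: kronecker_carrier)
  have herm_A: "hermitian A" and herm_B: "hermitian B"
    using A B by (auto simp: positive_semidefinite_def)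
  have bounds: "r div e < d" "r mod e < e" if "r < d * e" for r
  proof -
    have "0 < e" using that by (cases e) auto
    then show "r div e < d" "r mod e < e"
      using that by (auto simp: less_mult_imp_div_less)
  qed
  have "kronecker A B $$ (r, c) = cnj (kronecker A B $$ (c, r))" if "r < d * e" "c < d * e" for r c
    using that bounds
    by (simp add: kronecker_index[OF A(1) B(1)] hermitianD[OF herm_A A(1)] hermitianD[OF herm_B B(1)])
  then have herm: "hermitian (kronecker A B)"
    using hermitian_iff[OF K] by blast
  obtain u where u:
    "\<And>i j. i < d \<Longrightarrow> j < d \<Longrightarrow> A $$ (i, j) = (\<Sum>m<d. u m i * cnj (u m j))"
  proof -
    have "\<exists>u. \<forall>i\<in>{..<d}. \<forall>j\<in>{..<d}. A $$ (i, j) = (\<Sum>m<d. u m i * cnj (u m j))"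
    proof (rule gram_representation)
      show "A $$ (i, j) = cnj (A $$ (j, i))" if "i \<in> {..<d}" "j \<in> {..<d}" for i j
        using that by (simp add: hermitianD[OF herm_A A(1)])
    qed (use A positive_semidefinite_iff_quadratic_form[OF A(1)] in simp_all)
    then show thesis using that by auto
  qed
  have "0 \<le> (\<Sum>r<d * e. \<Sum>c<d * e. kronecker A B $$ (r, c) * x c * cnj (x r))" for x
  proof -
    define y where "y = (\<lambda>m l. \<Sum>j<d. cnj (u m j) * x (j * e + l))"
    have x: "x r = x (r div e * e + r mod e)" for r by simp
    have "(\<Sum>r<d * e. \<Sum>c<d * e. kronecker A B $$ (r, c) * x c * cnj (x r))
        = (\<Sum>r<d * e. \<Sum>c<d * e. A $$ (r div e, c div e) * B $$ (r mod e, c mod e)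
            * x (c div e * e + c mod e) * cnj (x (r div e * e + r mod e)))"
      by (intro sum.cong refl) (simp add: kronecker_index[OF A(1) B(1)])
    also have "\<dots> = (\<Sum>i<d. \<Sum>k<e. \<Sum>j<d. \<Sum>l<e.
        A $$ (i, j) * B $$ (k, l) * x (j * e + l) * cnj (x (i * e + k)))"
      by (simp only: sum_div_mod[of "\<lambda>j l. A $$ (_, j) * B $$ (_, l)
            * x (j * e + l) * cnj (x _)"]
          sum_div_mod[of "\<lambda>i k. \<Sum>j<d. \<Sum>l<e. A $$ (i, j) * B $$ (k, l)
            * x (j * e + l) * cnj (x (i * e + k))"])
    also have "\<dots> = (\<Sum>i<d. \<Sum>k<e. \<Sum>j<d. \<Sum>l<e. \<Sum>m<d.
        B $$ (k, l) * (cnj (u m j) * x (j * e + l)) * (u m i * cnj (x (i * e + k))))"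
      by (intro sum.cong refl) (simp add: u sum_distrib_left sum_distrib_right mult_ac)
    also have "\<dots> = (\<Sum>m<d. \<Sum>k<e. \<Sum>l<e. \<Sum>i<d. \<Sum>j<d.
        B $$ (k, l) * (cnj (u m j) * x (j * e + l)) * (u m i * cnj (x (i * e + k))))"
      unfolding sum.cartesian_product
      by (rule sum.reindex_bij_witness[where i = "\<lambda>(m, k, l, i, j). (i, k, j, l, m)"
            and j = "\<lambda>(i, k, j, l, m). (m, k, l, i, j)"]) auto
    also have "\<dots> = (\<Sum>m<d. \<Sum>k<e. \<Sum>l<e. B $$ (k, l) * y m l * cnj (y m k))"
      by (simp add: y_def sum_distrib_left sum_distrib_right mult.assoc)
    also have "0 \<le> \<dots>"
      using B positive_semidefinite_iff_quadratic_form[OF B(1)] by (intro sum_nonneg[of "{..<d}"]) simp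
    finally show ?thesis .
  qed
  then show ?thesis
    using herm positive_semidefinite_iff_quadratic_form[OF K] by blast
qed

lemma positive_semidefinite_tensor_power:
  assumes "A \<in> carrier_mat d d" "positive_semidefinite A"
  shows "positive_semidefinite (tensor_power A p)"
  using assms
  by (induction p)
    (auto intro: positive_semidefinite_kronecker tensor_power_carrier
      simp: positive_semidefinite_one[simplified])

section \<open>Expansion of a tensor power of a sum into words\<close>

fun tensor_word :: "('i \<Rightarrow> 'a::semiring_1 mat) \<Rightarrow> 'i list \<Rightarrow> 'a mat" where
  "tensor_word A [] = 1\<^sub>m 1"
| "tensor_word A (i # w) = kronecker (A i) (tensor_word A w)"

definition words :: "'i set \<Rightarrow> nat \<Rightarrow> 'i list set" where
  "words S p = {w. set w \<subseteq> S \<and> length w = p}"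

lemma finite_words: "finite S \<Longrightarrow> finite (words S p)"
  by (simp add: words_def finite_lists_length_eq)

lemma tensor_word_carrier:
  "(\<And>i. i \<in> set w \<Longrightarrow> A i \<in> carrier_mat d d) \<Longrightarrow>
    tensor_word A w \<in> carrier_mat (d ^ length w) (d ^ length w)"
  by (induction w) (auto intro!: kronecker_carrier)

lemma positive_semidefinite_tensor_word:
  "(\<And>i. i \<in> set w \<Longrightarrow> A i \<in> carrier_mat d d) \<Longrightarrow>
    (\<And>i. i \<in> set w \<Longrightarrow> positive_semidefinite (A i)) \<Longrightarrow>
    positive_semidefinite (tensor_word A w)"
  by (induction w)
    (auto intro: positive_semidefinite_kronecker tensor_word_carrier
      simp: positive_semidefinite_one[simplified])

lemma sum_words_Suc:
  "(\<Sum>w\<in>words S (Suc p). f w) = (\<Sum>i\<in>S. \<Sum>w\<in>words S p. f (i # w))"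
proof -
  have "(\<Sum>w\<in>words S (Suc p). f w) = (\<Sum>(w, i)\<in>words S p \<times> S. f (i # w))"
    unfolding words_def lists_length_Suc_eq
    by (subst sum.reindex) (auto simp: inj_on_def case_prod_unfold)
  also have "\<dots> = (\<Sum>i\<in>S. \<Sum>w\<in>words S p. f (i # w))"
    by (simp add: sum.cartesian_product sum.swap[of _ S] flip: sum.cartesian_product)
  finally show ?thesis .
qed

text \<open>
  This is multilinearity of the tensor product. It is stated for entries, where the recursion for
  the tensor power becomes the product of two ordinary sums.
\<close>

lemma tensor_power_finsum_index:
  fixes A :: "'i \<Rightarrow> 'a::comm_semiring_1 mat"
  assumes "finite S" and A: "\<And>i. i \<in> S \<Longrightarrow> A i \<in> carrier_mat d d"
    and "r < d ^ p" "c < d ^ p"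
  shows "tensor_power (finsum_mat TYPE('a) d d A S) p $$ (r, c)
    = (\<Sum>w\<in>words S p. tensor_word A w $$ (r, c))"
  using assms(3,4)
proof (induction p arbitrary: r c)
  case 0
  have "words S 0 = {[]}" by (auto simp: words_def)
  with 0 show ?case by simp
next
  case (Suc p)
  let ?F = "finsum_mat TYPE('a) d d A S" and ?e = "d ^ p"
  have F: "?F \<in> carrier_mat d d"
    using assms by (simp add: finsum_mat_carrier)
  have "0 < ?e" using Suc.prems by (cases "?e") auto
  then have bounds: "r div ?e < d" "r mod ?e < ?e" "c div ?e < d" "c mod ?e < ?e"
    using Suc.prems by (auto simp: less_mult_imp_div_less)
  have word: "tensor_word A (i # w) $$ (r, c)
      = A i $$ (r div ?e, c div ?e) * tensor_word A w $$ (r mod ?e, c mod ?e)"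
    if "i \<in> S" "w \<in> words S p" for i w
  proof -
    have "tensor_word A w \<in> carrier_mat ?e ?e"
      using that A tensor_word_carrier[of w A d] by (auto simp: words_def)
    then show ?thesis
      using kronecker_index[OF A[OF \<open>i \<in> S\<close>], of _ ?e ?e r c] Suc.prems by simp
  qed
  have "tensor_power ?F (Suc p) $$ (r, c)
      = ?F $$ (r div ?e, c div ?e) * tensor_power ?F p $$ (r mod ?e, c mod ?e)"
    using kronecker_index[OF F tensor_power_carrier[OF F]] Suc.prems by simp
  also have "\<dots> = (\<Sum>i\<in>S. A i $$ (r div ?e, c div ?e))
      * (\<Sum>w\<in>words S p. tensor_word A w $$ (r mod ?e, c mod ?e))"
    using bounds Suc.IH by (simp add: finsum_mat_entries[OF assms(1) A])
  also have "\<dots> = (\<Sum>i\<in>S. \<Sum>w\<in>words S p. tensor_word A (i # w) $$ (r, c))"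
    unfolding sum_product using word by (intro sum.cong refl) simp
  finally show ?case
    by (simp add: sum_words_Suc)
qed

section \<open>Counting the letters of a word\<close>

text \<open>
  Solved for the indicator of \<open>3 \<le> card X\<close>, this is the coefficient of a word with letter set
  \<open>X\<close> in the difference of the two sides of the inequality. It is an identity of integers because
  \<open>n - 2\<close> is negative for \<open>n = 1\<close>.
\<close>

lemma card_pairs_containing:
  fixes X :: "nat set"
  assumes "X \<subseteq> {1..n}" "X \<noteq> {}"
  shows "int (card {(i, j). 1 \<le> i \<and> i < j \<and> j \<le> n \<and> X \<subseteq> {i, j}})
    = (int n - 2) * int (card {i\<in>{1..n}. X \<subseteq> {i}}) + 1 - of_bool (3 \<le> card X)"
proof -
  let ?P = "{(i, j). 1 \<le> i \<and> i < j \<and> j \<le> n \<and> X \<subseteq> {i, j}}"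
  have "finite X" using assms finite_subset by blast
  then have "card X \<noteq> 0" using assms by simp
  then consider "card X = 1" | "card X = 2" | "3 \<le> card X" by linarith
  then show ?thesis
  proof cases
    case 1
    then obtain a where X: "X = {a}" by (auto simp: card_1_singleton_iff)
    have a: "1 \<le> a" "a \<le> n" using assms by (auto simp: X)
    \<comment> \<open>A pair containing \<open>a\<close> is determined by its other element.\<close>
    have "bij_betw (\<lambda>b. (min a b, max a b)) ({1..n} - {a}) ?P"
      by (rule bij_betw_byWitness[where f' = "\<lambda>(i, j). if i = a then j else i"])
        (use a in \<open>auto simp: X min_def max_def split: if_splits\<close>)
    then have "card ?P = n - 1"
      using a by (simp flip: bij_betw_same_card)
    moreover have "{i\<in>{1..n}. X \<subseteq> {i}} = {a}" using a by (auto simp: X)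
    ultimately show ?thesis using a 1 by (simp add: of_nat_diff)
  next
    case 2
    then obtain a b where X: "X = {a, b}" "a < b"
      by (metis card_2_iff insert_commute linorder_neqE_nat)
    have "?P = {(a, b)}" using assms X by auto
    moreover have "{i\<in>{1..n}. X \<subseteq> {i}} = {}" using X by auto
    ultimately show ?thesis using 2 by simp
  next
    case 3
    have "\<not> X \<subseteq> {i, j}" for i j
      using 3 card_mono[of "{i, j}" X] card_insert_le_m1[of 2 "{j}" i] by auto
    moreover from this have "\<not> X \<subseteq> {i}" for i by blast
    ultimately show ?thesis using 3 by simp
  qed
qed

text \<open>
  Double counting: a word over \<open>S\<close> occurs once for each alphabet \<open>T x\<close> that contains its letters.
\<close>

lemma sum_words_subset:
  fixes t :: "'i list \<Rightarrow> 'a::semiring_1"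
  assumes "finite S" "finite P" "\<And>x. x \<in> P \<Longrightarrow> T x \<subseteq> S"
  shows "(\<Sum>x\<in>P. \<Sum>w\<in>words (T x) p. t w)
    = (\<Sum>w\<in>words S p. of_nat (card {x\<in>P. set w \<subseteq> T x}) * t w)"
proof -
  have "(\<Sum>x\<in>P. \<Sum>w\<in>words (T x) p. t w)
      = (\<Sum>x\<in>P. \<Sum>w\<in>words S p. of_bool (set w \<subseteq> T x) * t w)"
  proof (rule sum.cong[OF refl])
    fix x assume "x \<in> P"
    then have "{w\<in>words S p. set w \<subseteq> T x} = words (T x) p"
      using assms(3) by (auto simp: words_def)
    then show "(\<Sum>w\<in>words (T x) p. t w) = (\<Sum>w\<in>words S p. of_bool (set w \<subseteq> T x) * t w)"
      using sum.inter_filter[OF finite_words[OF assms(1), of p], of t "\<lambda>w. set w \<subseteq> T x"]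
      by (simp add: of_bool_def if_distrib[of "\<lambda>b. b * _"] cong: if_cong)
  qed
  also have "\<dots> = (\<Sum>w\<in>words S p. \<Sum>x\<in>P. of_bool (set w \<subseteq> T x) * t w)"
    by (rule sum.swap)
  also have "\<dots> = (\<Sum>w\<in>words S p. of_nat (card {x\<in>P. set w \<subseteq> T x}) * t w)"
    using assms(2) by (simp flip: sum_distrib_right add: Int_def)
  finally show ?thesis .
qed

text \<open>
  Words with one or two distinct letters cancel. The hypothesis on \<open>p\<close> excludes the empty word, whose
  coefficient \<open>(n - 2) n + 1 - n (n - 1) / 2\<close> need not be \<open>0\<close>: it is \<open>1\<close> for \<open>n = 3\<close>.
\<close>

lemma sum_words_inclusion_exclusion:
  fixes t :: "nat list \<Rightarrow> complex"
  assumes "p \<ge> 1"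
  shows "(of_nat n - 2) * (\<Sum>i\<in>{1..n}. \<Sum>w\<in>words {i} p. t w) + (\<Sum>w\<in>words {1..n} p. t w)
      - (\<Sum>(i, j)\<in>{(i, j). 1 \<le> i \<and> i < j \<and> j \<le> n}. \<Sum>w\<in>words {i, j} p. t w)
    = (\<Sum>w\<in>{w\<in>words {1..n} p. 3 \<le> card (set w)}. t w)"
proof -
  let ?P = "{(i, j). 1 \<le> i \<and> i < j \<and> j \<le> n}" and ?W = "words {1..n} p"
  have "finite ?P" by (rule finite_subset[of _ "{1..n} \<times> {1..n}"]) auto
  have single: "(\<Sum>i\<in>{1..n}. \<Sum>w\<in>words {i} p. t w)
      = (\<Sum>w\<in>?W. of_nat (card {i\<in>{1..n}. set w \<subseteq> {i}}) * t w)"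
    by (rule sum_words_subset) auto
  have pair: "(\<Sum>(i, j)\<in>?P. \<Sum>w\<in>words {i, j} p. t w)
      = (\<Sum>w\<in>?W. of_nat (card {x\<in>?P. set w \<subseteq> {fst x, snd x}}) * t w)"
  proof -
    have "(\<Sum>(i, j)\<in>?P. \<Sum>w\<in>words {i, j} p. t w)
        = (\<Sum>x\<in>?P. \<Sum>w\<in>words {fst x, snd x} p. t w)"
      by (intro sum.cong) auto
    then show ?thesis
      using \<open>finite ?P\<close> by (subst (asm) sum_words_subset[of "{1..n}"]) auto
  qed
  have coeff: "(of_nat n - 2) * of_nat (card {i\<in>{1..n}. set w \<subseteq> {i}}) + 1
      - of_nat (card {x\<in>?P. set w \<subseteq> {fst x, snd x}}) = (of_bool (3 \<le> card (set w)) :: complex)"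
    if "w \<in> ?W" for w
  proof -
    have "set w \<subseteq> {1..n}" "set w \<noteq> {}"
      using that assms by (auto simp: words_def)
    moreover have "{x\<in>?P. set w \<subseteq> {fst x, snd x}}
        = {(i, j). 1 \<le> i \<and> i < j \<and> j \<le> n \<and> set w \<subseteq> {i, j}}" by auto
    ultimately have "(int n - 2) * int (card {i\<in>{1..n}. set w \<subseteq> {i}}) + 1
        - int (card {x\<in>?P. set w \<subseteq> {fst x, snd x}}) = of_bool (3 \<le> card (set w))"
      using card_pairs_containing[of "set w" n] by simp
    from arg_cong[where f = "of_int :: int \<Rightarrow> complex", OF this] show ?thesis
      by simp
  qed
  have "(of_nat n - 2) * (\<Sum>i\<in>{1..n}. \<Sum>w\<in>words {i} p. t w) + (\<Sum>w\<in>?W. t w)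
      - (\<Sum>(i, j)\<in>?P. \<Sum>w\<in>words {i, j} p. t w)
    = (\<Sum>w\<in>?W. ((of_nat n - 2) * of_nat (card {i\<in>{1..n}. set w \<subseteq> {i}}) + 1
        - of_nat (card {x\<in>?P. set w \<subseteq> {fst x, snd x}})) * t w)"
    unfolding single pair
    by (simp add: sum_distrib_left sum.distrib sum_subtractf left_diff_distrib distrib_right
        mult.assoc)
  also have "\<dots> = (\<Sum>w\<in>?W. of_bool (3 \<le> card (set w)) * t w)"
    by (intro sum.cong refl) (simp only: coeff)
  also have "\<dots> = (\<Sum>w\<in>{w\<in>?W. 3 \<le> card (set w)}. t w)"
    by (simp add: sum.inter_filter finite_words of_bool_def if_distrib[of "\<lambda>b. b * _"] cong: if_cong)
  finally show ?thesis .
qed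

section \<open>The inequality\<close>

theorem theorem4p3:
  fixes n d p :: nat and A :: "nat \<Rightarrow> complex mat"
  assumes "n \<ge> 1" and "p \<ge> 1"
    and "\<And>i. i \<in> {1..n} \<Longrightarrow> A i \<in> carrier_mat d d"
    and "\<And>i. i \<in> {1..n} \<Longrightarrow> positive_semidefinite (A i)"
  shows "loewner_le
    (finsum_mat TYPE(complex) (d ^ p) (d ^ p) (\<lambda>(i, j). tensor_power (A i + A j) p)
       {(i, j). 1 \<le> i \<and> i < j \<and> j \<le> n})
    ((of_nat n - 2) \<cdot>\<^sub>m
       finsum_mat TYPE(complex) (d ^ p) (d ^ p) (\<lambda>i. tensor_power (A i) p) {1..n}
     + tensor_power (finsum_mat TYPE(complex) d d A {1..n}) p)"
proof -
  note A = assms(3) and psd = assms(4)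
  let ?P = "{(i, j). 1 \<le> i \<and> i < j \<and> j \<le> n}" and ?N = "d ^ p"
  let ?Sum = "finsum_mat TYPE(complex)"
  let ?W = "{w\<in>words {1..n} p. 3 \<le> card (set w)}"
  define Y where "Y = ?Sum ?N ?N (\<lambda>(i, j). tensor_power (A i + A j) p) ?P"
  define X1 where "X1 = ?Sum ?N ?N (\<lambda>i. tensor_power (A i) p) {1..n}"
  define X2 where "X2 = tensor_power (?Sum d d A {1..n}) p"
  define X where "X = (of_nat n - 2) \<cdot>\<^sub>m X1 + X2"
  define R where "R = ?Sum ?N ?N (tensor_word A) ?W"
  have finP: "finite ?P" by (rule finite_subset[of _ "{1..n} \<times> {1..n}"]) auto
  have finW: "finite ?W" by (simp add: finite_words)
  have pair_sum: "A i + A j \<in> carrier_mat d d" "positive_semidefinite (A i + A j)"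
    if "i \<in> {1..n}" "j \<in> {1..n}" for i j
    using that A psd by (auto intro!: positive_semidefinite_add[of _ d])
  have Y_terms: "(\<lambda>(i, j). tensor_power (A i + A j) p) x \<in> carrier_mat ?N ?N"
    "positive_semidefinite ((\<lambda>(i, j). tensor_power (A i + A j) p) x)" if "x \<in> ?P" for x
    using that
    by (auto intro!: tensor_power_carrier positive_semidefinite_tensor_power[of _ d] pair_sum)
  have R_terms: "tensor_word A w \<in> carrier_mat ?N ?N" "positive_semidefinite (tensor_word A w)"
    if "w \<in> ?W" for w
  proof -
    have "set w \<subseteq> {1..n}" "length w = p" using that by (auto simp: words_def)
    then show "tensor_word A w \<in> carrier_mat ?N ?N" "positive_semidefinite (tensor_word A w)"
      using tensor_word_carrier[of w A d] positive_semidefinite_tensor_word[of w A d] A psd by blast+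
  qed
  have Y: "Y \<in> carrier_mat ?N ?N" "positive_semidefinite Y"
    unfolding Y_def using finP Y_terms
    by (blast intro: finsum_mat_carrier positive_semidefinite_finsum)+
  have R: "R \<in> carrier_mat ?N ?N" "positive_semidefinite R"
    unfolding R_def using finW R_terms
    by (blast intro: finsum_mat_carrier positive_semidefinite_finsum)+
  have X1: "X1 \<in> carrier_mat ?N ?N" "positive_semidefinite X1"
    unfolding X1_def using A psd
    by (blast intro: finsum_mat_carrier positive_semidefinite_finsum tensor_power_carrier
        positive_semidefinite_tensor_power finite_atLeastAtMost)+
  have X2: "X2 \<in> carrier_mat ?N ?N" "positive_semidefinite X2"
    unfolding X2_def using A psd
    by (blast intro: finsum_mat_carrier positive_semidefinite_finsum tensor_power_carrier
        positive_semidefinite_tensor_power finite_atLeastAtMost)+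
  have X: "X \<in> carrier_mat ?N ?N" "hermitian X"
    unfolding X_def using X1 X2
    by (auto intro!: hermitian_add[of _ ?N] hermitian_real_smult[of _ ?N]
        simp: positive_semidefinite_def)
  \<comment> \<open>The identity is checked entry by entry, where it becomes an identity of sums over words.\<close>
  have "X - Y = R"
  proof (rule eq_matI)
    fix r c assume "r < dim_row R" "c < dim_col R"
    then have rc: "r < ?N" "c < ?N" using R by auto
    define t where "t = (\<lambda>w. tensor_word A w $$ (r, c))"
    have single: "tensor_power (A i) p $$ (r, c) = (\<Sum>w\<in>words {i} p. t w)" if "i \<in> {1..n}" for i
    proof -
      have "A i = ?Sum d d A {i}"
        using A[OF that] finsum_mat_insert[of "{}" i A d d] by (simp add: finsum_mat_empty)
      moreover have "tensor_power (?Sum d d A {i}) p $$ (r, c) = (\<Sum>w\<in>words {i} p. t w)"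
        unfolding t_def by (rule tensor_power_finsum_index[OF _ _ rc]) (use A that in auto)
      ultimately show ?thesis by simp
    qed
    have pair: "tensor_power (A i + A j) p $$ (r, c) = (\<Sum>w\<in>words {i, j} p. t w)"
      if "(i, j) \<in> ?P" for i j
    proof -
      have ij: "i \<in> {1..n}" "j \<in> {1..n}" "i \<noteq> j" using that by auto
      have "A i + A j = ?Sum d d A {i, j}"
      proof -
        have "?Sum d d A {j} = A j"
          using A[OF ij(2)] finsum_mat_insert[of "{}" j A d d] by (simp add: finsum_mat_empty)
        moreover have "?Sum d d A {i, j} = A i + ?Sum d d A {j}"
          by (rule finsum_mat_insert) (use A ij in auto)
        ultimately show ?thesis by simp
      qed
      moreover have "tensor_power (?Sum d d A {i, j}) p $$ (r, c) = (\<Sum>w\<in>words {i, j} p. t w)"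
        unfolding t_def by (rule tensor_power_finsum_index[OF _ _ rc]) (use A ij in auto)
      ultimately show ?thesis by simp
    qed
    have "X1 $$ (r, c) = (\<Sum>i\<in>{1..n}. \<Sum>w\<in>words {i} p. t w)"
      unfolding X1_def using rc single
      by (subst finsum_mat_entries) (auto intro!: tensor_power_carrier A)
    moreover have "X2 $$ (r, c) = (\<Sum>w\<in>words {1..n} p. t w)"
      unfolding X2_def t_def by (rule tensor_power_finsum_index[OF _ A rc]) auto
    moreover have "Y $$ (r, c) = (\<Sum>(i, j)\<in>?P. \<Sum>w\<in>words {i, j} p. t w)"
    proof -
      have "Y $$ (r, c) = (\<Sum>x\<in>?P. (\<lambda>(i, j). tensor_power (A i + A j) p) x $$ (r, c))"
        unfolding Y_def using rc by (subst finsum_mat_entries[OF finP Y_terms(1)]) auto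
      also have "\<dots> = (\<Sum>(i, j)\<in>?P. \<Sum>w\<in>words {i, j} p. t w)"
        using pair by (intro sum.cong refl) auto
      finally show ?thesis .
    qed
    moreover have "R $$ (r, c) = (\<Sum>w\<in>?W. t w)"
      unfolding R_def t_def using rc by (subst finsum_mat_entries[OF finW R_terms(1)]) auto
    ultimately show "(X - Y) $$ (r, c) = R $$ (r, c)"
      using sum_words_inclusion_exclusion[OF \<open>p \<ge> 1\<close>, of n t] rc X1 X2 Y
      by (simp add: X_def)
  qed (use X Y R in auto)
  then have "loewner_le Y X"
    using X Y R by (auto simp: loewner_le_def positive_semidefinite_def)
  then show ?thesis
    unfolding X_def X1_def X2_def Y_def .
qed

end
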